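(* Let $K$ be a field of characteristic $0$. The coefficients $c(\tau)$, $\tau\in M(x,y)$, of the non-associative Hausdorff series $H(x,y)=\sum_{\tau\in M(x,y)}c(\tau)\tau$ are given by $$c(\tau)=d(\tau)-\sum_{k=2}^{\deg\tau}c_k(\tau),$$ where $$c_k(\tau)=\begin{cases}c(\tau)&: k=1\\ a(\vert\tau\vert)&: k=\deg\tau\\ \frac{1}{2^k-2}\sum_{l=1}^{k-1}c_l(\tau_1)\,c_{k-l}(\tau_2)&: 2\leq k<\deg\tau \text{ and } \tau=\tau_1\tau_2,\end{cases}$$ (with $c_k(\tau)=0$ for $k>\deg\tau$), while $d(\tau)$ is the coefficient of $\tau$ in $\exp(x)\exp(y)$, given by $$d(\tau)=\begin{cases}a(\vert\tau\vert)&\text{if }\tau\in M(x)\text{ or }\tau\in M(y),\\ a(\vert\tau_1\vert)\,a(\vert\tau_2\vert)&\text{if }\tau=\tau_1\tau_2,\ \tau_1\in M(x),\ \tau_2\in M(y),\\ 0&\text{else.}\end{cases}$$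
   Context: $M(X)$ is the free magma (without unit) on $X$ (planar binary rooted trees with leaves labeled by $X$), $\deg$ is the number of leaves; $M(x),M(y)\subset M(x,y)$. $K\{\{X\}\}$ is the algebra of power series in the non-associative variables $X$: infinite $K$-linear combinations of $1$ and elements of $M(X)$, i.e. the completion of the free unital non-associative algebra with respect to degree. $\exp(x)=1+\sum_{t\in M(x)}a(t)t\in K\{\{x\}\}$ is the unique series with constant term $1$ satisfying $\exp(x)\exp(x)=\exp(2x)$ and $\exp'(x)=\exp(x)$, where $'$ is the continuous derivation $\frac{d}{dx}$ with $\frac{d}{dx}x=1$. $\log(1+x)$ is the compositional inverse of $\exp(x)-1$, and $H(x,y)=\log(\exp(x)\exp(y))\in K\{\{x,y\}\}$. For $\tau\in M(x,y)$, $\vert\tau\vert$ denotes the underlying unlabeled tree, i.e. the image of $\tau$ under the magma homomorphism $M(x,y)\to M(z)$, $x\mapsto z$, $y\mapsto z$; identifying $M(z)$ with $M(x)$, $a(\vert\tau\vert)$ is the coefficient of this tree in $\exp$. *)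

theory Defs
  imports Main "HOL-Library.Groups_Big_Fun"
begin

section \<open>The free magma\<close>

datatype (gens: 'a) magma =
    Gen 'a
  | Mult "'a magma" "'a magma"  (infixl "\<cdot>" 70)

primrec deg :: "'a magma \<Rightarrow> nat" where
  "deg (Gen v) = 1"
| "deg (s \<cdot> t) = deg s + deg t"

text \<open>The submagma \<open>M(A)\<close> of the free magma on \<open>'a\<close>, for a set \<open>A\<close> of generators.\<close>

definition M :: "'a set \<Rightarrow> 'a magma set" where
  "M A = {t. gens t \<subseteq> A}"

text \<open>The free magma on one generator is \<^typ>\<open>unit magma\<close>. The underlying unlabeled tree is the
  image under the magma homomorphism sending every generator to the single one.\<close>

definition shape :: "'a magma \<Rightarrow> unit magma" where
  "shape t = map_magma (\<lambda>_. ()) t"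


section \<open>Power series in non-associative variables\<close>

text \<open>A monomial is \<^const>\<open>None\<close> (the unit \<open>1\<close>) or \<open>Some t\<close> with \<open>t\<close> in the free magma.
  A series is the family of its coefficients.\<close>

type_synonym 'a monomial = "'a magma option"
type_synonym ('a, 'k) nseries = "'a monomial \<Rightarrow> 'k"

fun mono_mult :: "'a monomial \<Rightarrow> 'a monomial \<Rightarrow> 'a monomial" where
  "mono_mult None v = v"
| "mono_mult u None = u"
| "mono_mult (Some s) (Some t) = Some (s \<cdot> t)"

definition ns_one :: "('a, 'k::field_char_0) nseries" where
  "ns_one u = (if u = None then 1 else 0)"

definition ns_var :: "'a \<Rightarrow> ('a, 'k::field_char_0) nseries" where
  "ns_var v u = (if u = Some (Gen v) then 1 else 0)"

definition ns_add :: "('a, 'k::field_char_0) nseries \<Rightarrow> ('a, 'k) nseries \<Rightarrow> ('a, 'k) nseries"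
    (infixl "\<oplus>" 65) where
  "(f \<oplus> g) u = f u + g u"

definition ns_minus :: "('a, 'k::field_char_0) nseries \<Rightarrow> ('a, 'k) nseries \<Rightarrow> ('a, 'k) nseries"
    (infixl "\<ominus>" 65) where
  "(f \<ominus> g) u = f u - g u"

definition ns_scale :: "'k::field_char_0 \<Rightarrow> ('a, 'k) nseries \<Rightarrow> ('a, 'k) nseries" where
  "ns_scale r f u = r * f u"

text \<open>A monomial has only finitely many factorizations, so the sum below is finite.\<close>

definition ns_mult :: "('a, 'k::field_char_0) nseries \<Rightarrow> ('a, 'k) nseries \<Rightarrow> ('a, 'k) nseries"
    (infixl "\<otimes>" 70) where
  "(f \<otimes> g) w = (\<Sum>(u, v) \<in> {(u, v). mono_mult u v = w}. f u * g v)"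

text \<open>\<open>tree_eval g t\<close> is the value \<open>t(g)\<close> of a tree \<open>t\<close> in one variable at the series \<open>g\<close>.\<close>

primrec tree_eval :: "('a, 'k::field_char_0) nseries \<Rightarrow> unit magma \<Rightarrow> ('a, 'k) nseries" where
  "tree_eval g (Gen v) = g"
| "tree_eval g (s \<cdot> t) = tree_eval g s \<otimes> tree_eval g t"

definition mono_eval :: "('a, 'k::field_char_0) nseries \<Rightarrow> unit monomial \<Rightarrow> ('a, 'k) nseries" where
  "mono_eval g u = (case u of None \<Rightarrow> ns_one | Some t \<Rightarrow> tree_eval g t)"

text \<open>Substitution \<open>f(g)\<close> of \<open>g\<close> into a series \<open>f\<close> in one variable. It is meaningful when \<open>g\<close> has
  constant term \<open>0\<close>: then \<open>t(g)\<close> has no terms of degree below \<open>deg t\<close>, so that for each \<open>w\<close> only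
  finitely many summands are nonzero, as \<^const>\<open>Sum_any\<close> requires.\<close>

definition ns_subst :: "(unit, 'k::field_char_0) nseries \<Rightarrow> ('a, 'k) nseries \<Rightarrow> ('a, 'k) nseries" where
  "ns_subst f g w = Sum_any (\<lambda>u. f u * mono_eval g u w)"

text \<open>The continuous derivation \<open>d/dx\<close> of \<open>K{{x}}\<close> with \<open>d/dx x = 1\<close>: on trees it is determined by the
  Leibniz rule, and it is extended to series by linearity and continuity. As \<open>d/dx\<close> lowers
  the degree by one, each coefficient is a finite sum.\<close>

primrec tree_deriv :: "unit magma \<Rightarrow> (unit, 'k::field_char_0) nseries" where
  "tree_deriv (Gen v) = ns_one"
| "tree_deriv (s \<cdot> t) =
     (tree_deriv s \<otimes> (\<lambda>u. if u = Some t then 1 else 0)) \<oplus>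
     ((\<lambda>u. if u = Some s then 1 else 0) \<otimes> tree_deriv t)"

definition ns_deriv :: "(unit, 'k::field_char_0) nseries \<Rightarrow> (unit, 'k) nseries" where
  "ns_deriv f w = Sum_any (\<lambda>t. f (Some t) * tree_deriv t w)"


section \<open>Exponential, logarithm and the Hausdorff series\<close>

definition is_exp :: "(unit, 'k::field_char_0) nseries \<Rightarrow> bool" where
  "is_exp E \<longleftrightarrow> E None = 1 \<and> E \<otimes> E = ns_subst E (ns_scale 2 (ns_var ())) \<and> ns_deriv E = E"

definition na_exp :: "(unit, 'k::field_char_0) nseries" where
  "na_exp = (THE E. is_exp E)"

definition exp_coeff :: "unit magma \<Rightarrow> 'k::field_char_0" where
  "exp_coeff t = na_exp (Some t)"

definition is_comp_inverse ::
    "(unit, 'k::field_char_0) nseries \<Rightarrow> (unit, 'k) nseries \<Rightarrow> bool" where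
  "is_comp_inverse f g \<longleftrightarrow>
     g None = 0 \<and> ns_subst f g = ns_var () \<and> ns_subst g f = ns_var ()"

text \<open>\<open>na_log1p\<close> is the series \<open>log(1 + x)\<close>.\<close>

definition na_log1p :: "(unit, 'k::field_char_0) nseries" where
  "na_log1p = (THE L. is_comp_inverse (na_exp \<ominus> ns_one) L)"

datatype var = X | Y

definition exp_exp :: "(var, 'k::field_char_0) nseries" where
  "exp_exp = ns_subst na_exp (ns_var X) \<otimes> ns_subst na_exp (ns_var Y)"

definition hausdorff :: "(var, 'k::field_char_0) nseries" where
  "hausdorff = ns_subst na_log1p (exp_exp \<ominus> ns_one)"

text \<open>\<open>c_part c \<tau> k\<close> is \<open>c\<^sub>k(\<tau>)\<close>, built from the given family \<open>c\<close>, which enters through \<open>c\<^sub>1 = c\<close>.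
  For \<open>deg \<tau> = 1\<close> the clauses for \<open>k = 1\<close> and \<open>k = deg \<tau>\<close> overlap; the former is taken.
  The value at \<open>k = 0\<close> is irrelevant.\<close>

primrec c_part :: "(var magma \<Rightarrow> 'k::field_char_0) \<Rightarrow> var magma \<Rightarrow> nat \<Rightarrow> 'k" where
  "c_part c (Gen v) k = (if k = 1 then c (Gen v) else 0)"
| "c_part c (\<tau>\<^sub>1 \<cdot> \<tau>\<^sub>2) k =
    (if k = 1 then c (\<tau>\<^sub>1 \<cdot> \<tau>\<^sub>2)
     else if k = deg (\<tau>\<^sub>1 \<cdot> \<tau>\<^sub>2) then exp_coeff (shape (\<tau>\<^sub>1 \<cdot> \<tau>\<^sub>2))
     else if 2 \<le> k \<and> k < deg (\<tau>\<^sub>1 \<cdot> \<tau>\<^sub>2)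
       then 1 / (2 ^ k - 2) * (\<Sum>l = 1..k - 1. c_part c \<tau>\<^sub>1 l * c_part c \<tau>\<^sub>2 (k - l))
     else 0)"

end

theory Submission
  imports Defs
begin

text \<open>
  The recursion is the equation \<open>exp(H) = exp(x) exp(y)\<close> read off coefficientwise. Comparing
  coefficients in \<open>exp(x) exp(x) = exp(2x)\<close> gives
  \<open>(2\<^sup>n - 2) a(\<tau>\<^sub>1\<tau>\<^sub>2) = a(\<tau>\<^sub>1) a(\<tau>\<^sub>2)\<close> for a tree of degree \<open>n \<ge> 2\<close>. For a series \<open>h\<close> without
  constant term, let \<open>h\<^sub>k(\<tau>)\<close> be the coefficient of \<open>\<tau>\<close> in the part
  \<open>\<Sum>\<^bsub>deg u = k\<^esub> a(u) u(h)\<close> of \<open>exp(h)\<close>. If \<open>k \<ge> 2\<close>, then every \<open>u\<close> in this sum is a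
  product \<open>u\<^sub>1u\<^sub>2\<close>, and the coefficient of \<open>\<tau>\<^sub>1\<tau>\<^sub>2\<close> in \<open>u\<^sub>1(h) u\<^sub>2(h)\<close> is the product of those of
  \<open>\<tau>\<^sub>1\<close> and \<open>\<tau>\<^sub>2\<close>, because the free magma has unique factorization and \<open>h\<close> has no constant
  term. Hence \<open>(2\<^sup>k - 2) h\<^sub>k(\<tau>\<^sub>1\<tau>\<^sub>2) = \<Sum>\<^sub>l h\<^sub>l(\<tau>\<^sub>1) h\<^bsub>k-l\<^esub>(\<tau>\<^sub>2)\<close> (\<open>exp_layer_eq\<close>), while
  \<open>h\<^sub>1 = h\<close> and \<open>h\<^sub>k(\<tau>) = 0\<close> for \<open>k > deg \<tau>\<close>. For \<open>h = H\<close> the sum over all \<open>k\<close> is the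
  coefficient \<open>d(\<tau>)\<close> of \<open>exp(x) exp(y)\<close>. The separate value \<open>a(|\<tau>|)\<close> at \<open>k = deg \<tau>\<close> is
  consistent with this recursion since \<open>c\<close> is \<open>1\<close> at both generators.

  What remains is to show that \<open>exp\<close> and \<open>log\<close>, given by unique descriptions, exist.
  The series with the coefficients \<open>a\<close> is its own derivative (\<open>ns_deriv_a_series\<close>): the
  functional equation, differentiated, determines the derivative from its constant term.
  As \<open>h\<^sub>k(\<tau>)\<close> for \<open>k \<ge> 2\<close> involves only the values of \<open>h\<close> at proper subtrees of \<open>\<tau>\<close>, the
  equation \<open>exp(h) - 1 = q\<close> is triangular in the coefficients of \<open>h\<close>, so that it has exactly one
  solution \<open>h\<close> (\<open>ns_subst_exp_inj\<close>, \<open>ns_subst_exp_surj\<close>). For \<open>q = x\<close> this is a right inverse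
  \<open>L\<close> of \<open>P = exp - 1\<close>; it is a left inverse too, as \<open>P(L(P)) = P = P(x)\<close>. Both this step and
  \<open>P(H) = P(L(exp(x) exp(y) - 1)) = exp(x) exp(y) - 1\<close> rest on the associativity of
  substitution (\<open>ns_subst_assoc\<close>).
\<close>

section \<open>Degrees and finiteness\<close>

lemma deg_pos: "0 < deg t"
  by (induction t) auto

lemma deg_ne_0 [simp]: "deg t \<noteq> 0"
  using deg_pos[of t] by linarith

lemma finite_deg_le: "finite {t :: 'a::finite magma. deg t \<le> n}"
proof (induction n)
  case 0
  have "{t :: 'a magma. deg t \<le> 0} = {}"
    by simp
  then show ?case by simp
next
  case (Suc n)
  let ?T = "{t :: 'a magma. deg t \<le> n}"
  have "{t :: 'a magma. deg t \<le> Suc n} \<subseteq> range Gen \<union> (\<lambda>(s, t). s \<cdot> t) ` (?T \<times> ?T)"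
  proof
    fix t :: "'a magma" assume t: "t \<in> {t. deg t \<le> Suc n}"
    show "t \<in> range Gen \<union> (\<lambda>(s, t). s \<cdot> t) ` (?T \<times> ?T)"
    proof (cases t)
      case (Mult s s')
      then show ?thesis using t deg_pos[of s] deg_pos[of s'] by force
    qed auto
  qed
  then show ?case
    by (rule finite_subset) (use Suc.IH in auto)
qed

lemma finite_deg_eq: "finite {t :: 'a::finite magma. deg t = n}"
  by (rule finite_subset[OF _ finite_deg_le[of n]]) auto

definition mdeg :: "'a monomial \<Rightarrow> nat" where
  "mdeg u = (case u of None \<Rightarrow> 0 | Some t \<Rightarrow> deg t)"

lemma mdeg_simps [simp]: "mdeg None = 0" "mdeg (Some t) = deg t"
  by (simp_all add: mdeg_def)

lemma mdeg_mono_mult [simp]: "mdeg (mono_mult u v) = mdeg u + mdeg v"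
  by (cases "(u, v)" rule: mono_mult.cases) auto

definition monomials :: "nat \<Rightarrow> unit monomial set" where
  "monomials n = {u. mdeg u \<le> n}"

lemma monomials_eq: "monomials n = insert None (Some ` {t. deg t \<le> n})"
proof (rule set_eqI)
  fix u show "u \<in> monomials n \<longleftrightarrow> u \<in> insert None (Some ` {t. deg t \<le> n})"
    by (cases u) (auto simp: monomials_def)
qed

lemma finite_monomials: "finite (monomials n)"
  by (simp add: monomials_eq finite_deg_le)


section \<open>The product of series\<close>

definition factorizations :: "'a monomial \<Rightarrow> ('a monomial \<times> 'a monomial) set" where
  "factorizations w = {(u, v). mono_mult u v = w}"

lemma mono_mult_None_right [simp]: "mono_mult u None = u"
  by (cases u) auto

lemma mono_mult_eq_None [simp]: "mono_mult u v = None \<longleftrightarrow> u = None \<and> v = None"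
  by (cases "(u, v)" rule: mono_mult.cases) auto

lemma mono_mult_eq_Gen [simp]: "mono_mult u v = Some (Gen a) \<longleftrightarrow>
    (u = None \<and> v = Some (Gen a)) \<or> (u = Some (Gen a) \<and> v = None)"
  by (cases "(u, v)" rule: mono_mult.cases) auto

lemma mono_mult_eq_Mult [simp]: "mono_mult u v = Some (s \<cdot> t) \<longleftrightarrow>
    (u = None \<and> v = Some (s \<cdot> t)) \<or> (u = Some (s \<cdot> t) \<and> v = None) \<or>
    (u = Some s \<and> v = Some t)"
  by (cases "(u, v)" rule: mono_mult.cases) auto

lemma factorizations_None: "factorizations None = {(None, None)}"
  and factorizations_Gen:
    "factorizations (Some (Gen a)) = {(None, Some (Gen a)), (Some (Gen a), None)}"
  and factorizations_Mult:
    "factorizations (Some (s \<cdot> t)) =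
      {(None, Some (s \<cdot> t)), (Some (s \<cdot> t), None), (Some s, Some t)}"
  by (auto simp: factorizations_def)

lemma finite_factorizations: "finite (factorizations w)"
proof (cases w)
  case (Some t)
  then show ?thesis by (cases t) (simp_all add: factorizations_Gen factorizations_Mult)
qed (simp add: factorizations_None)

lemma ns_mult_alt: "(f \<otimes> g) w = (\<Sum>(u, v) \<in> factorizations w. f u * g v)"
  by (simp add: ns_mult_def factorizations_def)

lemma ns_mult_None [simp]: "(f \<otimes> g) None = f None * g None"
  by (simp add: ns_mult_alt factorizations_None)

lemma ns_mult_Gen [simp]:
  "(f \<otimes> g) (Some (Gen a)) = f None * g (Some (Gen a)) + f (Some (Gen a)) * g None"
  by (simp add: ns_mult_alt factorizations_Gen)

lemma ns_mult_Mult [simp]: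
  "(f \<otimes> g) (Some (s \<cdot> t)) =
     f None * g (Some (s \<cdot> t)) + f (Some (s \<cdot> t)) * g None + f (Some s) * g (Some t)"
proof -
  have "s \<noteq> s \<cdot> t" "t \<noteq> s \<cdot> t"
    by (metis add_less_cancel_left add_less_cancel_right add_0 add_0_right
        deg.simps(2) deg_pos less_irrefl)+
  then show ?thesis by (simp add: ns_mult_alt factorizations_Mult)
qed

lemma series_eqI:
  assumes "f None = g None" and "\<And>a. f (Some (Gen a)) = g (Some (Gen a))"
    and "\<And>s t. f (Some (s \<cdot> t)) = g (Some (s \<cdot> t))"
  shows "f = g"
proof
  fix w show "f w = g w"
  proof (cases w)
    case (Some t)
    then show ?thesis using assms by (cases t) auto
  qed (use assms in auto)
qed

lemma ns_one_mult [simp]: "ns_one \<otimes> f = f"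
  and ns_mult_one [simp]: "f \<otimes> ns_one = f"
  by (rule series_eqI; simp add: ns_one_def)+


section \<open>Substitution\<close>

lemma tree_eval_None [simp]:
  assumes "g None = 0" shows "tree_eval g t None = 0"
  using assms by (induction t) auto

lemma tree_eval_eq_0:
  assumes "g None = 0" and "mdeg w < deg t" shows "tree_eval g t w = 0"
  using assms(2)
proof (induction t arbitrary: w)
  case (Gen v)
  then show ?case using assms(1) by (cases w) auto
next
  case (Mult s t)
  show ?case unfolding tree_eval.simps ns_mult_alt
  proof (rule sum.neutral, clarify)
    fix u v assume "(u, v) \<in> factorizations w"
    then have "mdeg u + mdeg v = mdeg w"
      by (auto simp: factorizations_def)
    then have "mdeg u < deg s \<or> mdeg v < deg t" using Mult.prems by auto
    then show "tree_eval g s u * tree_eval g t v = 0" using Mult.IH by auto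
  qed
qed

lemma mono_eval_eq_0:
  assumes "g None = 0" and "mdeg w < mdeg u" shows "mono_eval g u w = 0"
  using assms by (cases u) (auto simp: mono_eval_def tree_eval_eq_0)

lemma mono_eval_mono_mult:
  "mono_eval g (mono_mult u v) = mono_eval g u \<otimes> mono_eval g v"
  by (cases "(u, v)" rule: mono_mult.cases) (auto simp: mono_eval_def)

text \<open>Any bound \<open>n \<ge> mdeg w\<close> is allowed, so that coefficients at different monomials can be written as
  sums over the same finite range. This is what makes interchanging summations possible.\<close>

lemma ns_subst_eq_sum:
  assumes "g None = 0" and "mdeg w \<le> n"
  shows "ns_subst f g w = (\<Sum>u \<in> monomials n. f u * mono_eval g u w)"
  unfolding ns_subst_def
proof (rule Sum_any.expand_superset[OF finite_monomials])
  show "{u. f u * mono_eval g u w \<noteq> 0} \<subseteq> monomials n"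
    using assms mono_eval_eq_0[of g w] by (force simp: monomials_def not_less[symmetric])
qed

lemma ns_subst_None:
  assumes "g None = 0" shows "ns_subst f g None = f None"
proof -
  have "monomials 0 = {None}"
    by (simp add: monomials_eq)
  then show ?thesis
    using ns_subst_eq_sum[of g None 0 f, OF assms] by (simp add: mono_eval_def ns_one_def)
qed

text \<open>Substitution is an algebra homomorphism in the outer series. After truncation both sides are
  the double sum of \<open>f u * g v * mono_eval h (mono_mult u v) w\<close>.\<close>

lemma ns_subst_mult:
  fixes h :: "('b, 'k::field_char_0) nseries"
  assumes h: "h None = 0"
  shows "ns_subst (f \<otimes> g) h = ns_subst f h \<otimes> ns_subst g h"
proof
  fix w :: "'b monomial"
  define n where "n = mdeg w"
  let ?B = "monomials n" and ?e = "mono_eval h"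
  have w: "mdeg w \<le> n" by (simp add: n_def)
  define F where "F = (\<lambda>(u, v). f u * g v * ?e (mono_mult u v) w)"
  have "ns_subst (f \<otimes> g) h w = (\<Sum>m \<in> ?B. \<Sum>p \<in> factorizations m. F p)"
    unfolding ns_subst_eq_sum[of h w n, OF h w] ns_mult_alt
    by (intro sum.cong refl)
      (auto simp: F_def sum_distrib_right factorizations_def intro!: sum.cong)
  also have "\<dots> = sum F (\<Union>m \<in> ?B. factorizations m)"
    by (rule sum.UNION_disjoint[symmetric])
      (auto simp: finite_monomials finite_factorizations, auto simp: factorizations_def)
  \<comment> \<open>A pair of monomials whose product has degree above \<open>n\<close> does not contribute to \<open>w\<close>.\<close>
  also have "\<dots> = sum F (?B \<times> ?B)"
  proof (rule sum.mono_neutral_left)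
    show "\<forall>p \<in> ?B \<times> ?B - (\<Union>m \<in> ?B. factorizations m). F p = 0"
      using h by (auto simp: F_def factorizations_def monomials_def n_def intro!: mono_eval_eq_0)
  qed (auto simp: finite_monomials factorizations_def, auto simp: monomials_def)
  also have "\<dots> = (\<Sum>(u, v) \<in> ?B \<times> ?B. \<Sum>(p, q) \<in> factorizations w.
      (f u * ?e u p) * (g v * ?e v q))"
    by (auto intro!: sum.cong
        simp: F_def mono_eval_mono_mult ns_mult_alt sum_distrib_left mult_ac)
  also have "\<dots> = (\<Sum>(p, q) \<in> factorizations w. \<Sum>(u, v) \<in> ?B \<times> ?B.
      (f u * ?e u p) * (g v * ?e v q))"
    unfolding case_prod_unfold by (rule sum.swap)
  also have "\<dots> = (\<Sum>(p, q) \<in> factorizations w. ns_subst f h p * ns_subst g h q)"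
  proof (intro sum.cong refl, clarify)
    fix p q assume "(p, q) \<in> factorizations w"
    then have "mdeg p + mdeg q = mdeg w"
      by (auto simp: factorizations_def)
    then have le: "mdeg p \<le> n" "mdeg q \<le> n"
      by (auto simp: n_def)
    show "(\<Sum>(u, v) \<in> ?B \<times> ?B. (f u * ?e u p) * (g v * ?e v q)) = ns_subst f h p * ns_subst g h q"
      unfolding ns_subst_eq_sum[of h p, OF h le(1)] ns_subst_eq_sum[of h q, OF h le(2)]
      by (simp add: sum_product sum.cartesian_product)
  qed
  finally show "ns_subst (f \<otimes> g) h w = (ns_subst f h \<otimes> ns_subst g h) w"
    by (simp add: ns_mult_alt)
qed

lemma ns_subst_minus:
  assumes "h None = 0"
  shows "ns_subst (f \<ominus> g) h = ns_subst f h \<ominus> ns_subst g h"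
  by (rule ext)
    (simp add: ns_minus_def ns_subst_eq_sum[of h, OF assms order_refl] sum_subtractf left_diff_distrib)

lemma ns_subst_one: "ns_subst ns_one h = ns_one"
proof
  fix w
  have "ns_subst ns_one h w = (\<Sum>u \<in> {None}. ns_one u * mono_eval h u w)"
    unfolding ns_subst_def by (rule Sum_any.expand_superset) (auto simp: ns_one_def)
  then show "ns_subst ns_one h w = ns_one w" by (simp add: ns_one_def mono_eval_def)
qed

lemma ns_subst_var_left: "ns_subst (ns_var v) h = h"
proof
  fix w
  have "ns_subst (ns_var v) h w = (\<Sum>u \<in> {Some (Gen v)}. ns_var v u * mono_eval h u w)"
    unfolding ns_subst_def by (rule Sum_any.expand_superset) (auto simp: ns_var_def)
  then show "ns_subst (ns_var v) h w = h w" by (simp add: ns_var_def mono_eval_def)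
qed

lemma mono_eval_ns_subst:
  assumes "h None = 0"
  shows "mono_eval (ns_subst g h) u = ns_subst (mono_eval g u) h"
proof (cases u)
  case None
  then show ?thesis by (simp add: mono_eval_def ns_subst_one)
next
  case (Some t)
  have "tree_eval (ns_subst g h) t = ns_subst (tree_eval g t) h"
    by (induction t) (simp_all add: ns_subst_mult[of h, OF assms])
  with Some show ?thesis by (simp add: mono_eval_def)
qed

text \<open>Associativity of substitution: as evaluation at \<open>h\<close> is a homomorphism, it commutes with the
  evaluation of each tree at \<open>g\<close>, and then the two finite summations are interchanged.\<close>

lemma ns_subst_assoc:
  fixes h :: "('b, 'k::field_char_0) nseries"
  assumes g: "g None = 0" and h: "h None = 0"
  shows "ns_subst f (ns_subst g h) = ns_subst (ns_subst f g) h"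
proof
  fix w :: "'b monomial"
  define n where "n = mdeg w"
  have gh: "ns_subst g h None = 0" using ns_subst_None[of h g, OF h] g by simp
  have w: "mdeg w \<le> n" by (simp add: n_def)
  have "ns_subst f (ns_subst g h) w =
      (\<Sum>u \<in> monomials n. f u * (\<Sum>v \<in> monomials n. mono_eval g u v * mono_eval h v w))"
    by (simp add: ns_subst_eq_sum[of "ns_subst g h", OF gh w] mono_eval_ns_subst[of h, OF h]
        ns_subst_eq_sum[of h, OF h w])
  also have "\<dots> = (\<Sum>v \<in> monomials n. \<Sum>u \<in> monomials n. f u * mono_eval g u v * mono_eval h v w)"
    by (subst sum.swap) (simp add: sum_distrib_left mult.assoc)
  also have "\<dots> = (\<Sum>v \<in> monomials n. ns_subst f g v * mono_eval h v w)"
  proof (intro sum.cong refl)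
    fix v assume "v \<in> monomials n"
    then have "mdeg v \<le> n" by (simp add: monomials_def)
    then show "(\<Sum>u \<in> monomials n. f u * mono_eval g u v * mono_eval h v w) =
        ns_subst f g v * mono_eval h v w"
      by (simp add: ns_subst_eq_sum[of g, OF g] sum_distrib_right)
  qed
  also have "\<dots> = ns_subst (ns_subst f g) h w"
    by (simp add: ns_subst_eq_sum[of h, OF h w])
  finally show "ns_subst f (ns_subst g h) w = ns_subst (ns_subst f g) h w" .
qed

text \<open>The factor \<open>r\<close> serves both substitutions needed: \<open>r = 2\<close> in the functional equation of \<open>exp\<close>, and
  \<open>r = 1\<close> in \<open>exp(x)\<close> and \<open>exp(y)\<close>.\<close>

lemma tree_eval_scaled_var:
  "tree_eval (ns_scale r (ns_var v)) t w =
     (if w = Some (map_magma (\<lambda>_. v) t) then r ^ deg t else 0)"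
proof (induction t arbitrary: w)
  case (Gen a)
  then show ?case by (simp add: ns_scale_def ns_var_def)
next
  case (Mult s t)
  show ?case
  proof (cases w)
    case (Some p)
    then show ?thesis by (cases p) (auto simp: Mult.IH power_add)
  qed (simp add: Mult.IH)
qed

lemma in_M_Gen [simp]: "Gen w \<in> M {v} \<longleftrightarrow> w = v"
  and in_M_Mult [simp]: "s \<cdot> t \<in> M {v} \<longleftrightarrow> s \<in> M {v} \<and> t \<in> M {v}"
  by (auto simp: M_def)

lemma shape_simps [simp]: "shape (Gen v) = Gen ()" "shape (s \<cdot> t) = shape s \<cdot> shape t"
  by (simp_all add: shape_def)

lemma deg_shape [simp]: "deg (shape t) = deg t"
  by (induction t) auto

lemma shape_unit [simp]: "shape t = t"
  by (induction t) auto

lemma in_M_unit [simp]: "t \<in> M {v :: unit}"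
  by (auto simp: M_def)

lemma eq_map_const_iff:
  "t = map_magma (\<lambda>_. v) u \<longleftrightarrow> t \<in> M {v} \<and> u = shape t"
proof
  assume "t = map_magma (\<lambda>_. v) u"
  moreover have "map_magma (\<lambda>_. v) u \<in> M {v} \<and> shape (map_magma (\<lambda>_. v) u) = u"
    by (induction u) auto
  ultimately show "t \<in> M {v} \<and> u = shape t" by simp
next
  have "t \<in> M {v} \<Longrightarrow> t = map_magma (\<lambda>_. v) (shape t)"
    by (induction t) auto
  then show "t \<in> M {v} \<and> u = shape t \<Longrightarrow> t = map_magma (\<lambda>_. v) u" by auto
qed

lemma ns_subst_scaled_var:
  "ns_subst f (ns_scale r (ns_var v)) (Some t) =
     (if t \<in> M {v} then f (Some (shape t)) * r ^ deg t else 0)"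
proof -
  let ?g = "ns_scale r (ns_var v)"
  have eval: "mono_eval ?g u (Some t) =
      (if t \<in> M {v} \<and> u = Some (shape t) then r ^ deg t else 0)" for u
    by (cases u) (auto simp: mono_eval_def ns_one_def tree_eval_scaled_var eq_map_const_iff)
  have "ns_subst f ?g (Some t) = (\<Sum>u \<in> {Some (shape t)}. f u * mono_eval ?g u (Some t))"
    unfolding ns_subst_def by (rule Sum_any.expand_superset) (auto simp: eval)
  then show ?thesis by (simp add: eval)
qed

lemma ns_scale_1: "ns_scale 1 f = f"
  by (simp add: ns_scale_def fun_eq_iff)

lemma ns_var_None [simp]: "ns_var v None = 0"
  by (simp add: ns_var_def)

lemma ns_subst_var:
  "ns_subst f (ns_var v) (Some t) = (if t \<in> M {v} then f (Some (shape t)) else 0)"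
  using ns_subst_scaled_var[of f 1 v t] by (simp add: ns_scale_1)

lemma ns_subst_var_right: "ns_subst f (ns_var ()) = f"
proof
  fix w show "ns_subst f (ns_var ()) w = f w"
    by (cases w) (simp_all add: ns_subst_None ns_subst_var)
qed


section \<open>The exponential series\<close>

lemma two_power_ne_two: "2 \<le> k \<Longrightarrow> (2 :: 'k::field_char_0) ^ k - 2 \<noteq> 0"
proof -
  assume "2 \<le> k"
  then have "(2::nat) ^ 2 \<le> 2 ^ k" by (intro power_increasing) auto
  then have "of_nat (2 ^ k) \<noteq> (of_nat 2 :: 'k)" unfolding of_nat_eq_iff by simp
  then show ?thesis by simp
qed

lemma two_le_deg_Mult: "2 \<le> deg (s \<cdot> t)"
  using deg_pos[of s] deg_pos[of t] by simp

lemma two_power_deg_Mult: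
  fixes s t :: "'a magma"
  shows "(2 :: 'k::field_char_0) ^ (deg s + deg t) - 2 \<noteq> 0"
  using two_power_ne_two[OF two_le_deg_Mult[of s t]] by simp

text \<open>The recursion that \<open>exp(x) exp(x) = exp(2x)\<close> imposes on the coefficients; the value at the
  generator is the constant term \<open>1\<close> of the derivative.\<close>

primrec a_coeff :: "unit magma \<Rightarrow> 'k::field_char_0" where
  "a_coeff (Gen v) = 1"
| "a_coeff (s \<cdot> t) = a_coeff s * a_coeff t / (2 ^ deg (s \<cdot> t) - 2)"

definition a_series :: "(unit, 'k::field_char_0) nseries" where
  "a_series u = (case u of None \<Rightarrow> 1 | Some t \<Rightarrow> a_coeff t)"

lemma a_series_simps [simp]: "a_series None = 1" "a_series (Some t) = a_coeff t"
  by (simp_all add: a_series_def)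

lemma tree_deriv_eq_0:
  "deg t \<noteq> Suc (mdeg w) \<Longrightarrow> tree_deriv t w = (0 :: 'k::field_char_0)"
proof (induction t arbitrary: w)
  case (Gen v)
  then show ?case by (cases w) (auto simp: ns_one_def)
next
  case (Mult s t)
  have "(\<Sum>(u, v) \<in> factorizations w. tree_deriv s u * (if v = Some t then 1 else 0)) = (0 :: 'k)"
    using Mult.prems by (intro sum.neutral) (auto simp: factorizations_def intro!: Mult.IH(1))
  moreover
  have "(\<Sum>(u, v) \<in> factorizations w. (if u = Some s then 1 else 0) * tree_deriv t v) = (0 :: 'k)"
    using Mult.prems by (intro sum.neutral) (auto simp: factorizations_def intro!: Mult.IH(2))
  ultimately show ?case by (simp add: ns_add_def ns_mult_alt)
qed

lemma ns_deriv_eq_sum: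
  assumes "mdeg w < n"
  shows "ns_deriv f w = (\<Sum>t | deg t \<le> n. f (Some t) * tree_deriv t w)"
  unfolding ns_deriv_def
proof (rule Sum_any.expand_superset[OF finite_deg_le])
  show "{t. f (Some t) * tree_deriv t w \<noteq> 0} \<subseteq> {t. deg t \<le> n}"
  proof
    fix t assume "t \<in> {t. f (Some t) * tree_deriv t w \<noteq> 0}"
    then have "deg t = Suc (mdeg w)" using tree_deriv_eq_0[of t w] by auto
    then show "t \<in> {t. deg t \<le> n}" using assms by simp
  qed
qed

lemma trees_deg_le_1: "{t :: unit magma. deg t \<le> Suc 0} = {Gen ()}"
proof (rule set_eqI)
  fix t :: "unit magma"
  show "t \<in> {t. deg t \<le> Suc 0} \<longleftrightarrow> t \<in> {Gen ()}"
  proof (cases t)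
    case (Mult s s')
    then show ?thesis using deg_pos[of s] deg_pos[of s'] by simp
  qed simp
qed

lemma ns_deriv_None: "ns_deriv f None = f (Some (Gen ()))"
  using ns_deriv_eq_sum[of None "Suc 0" f] by (simp add: trees_deg_le_1 ns_one_def)

text \<open>The two factors may run over all trees of degree at most \<open>n\<close>, as \<open>b\<close> vanishes at the products
  that are too large. So the right-hand side has a rectangular range and splits into products.\<close>

lemma sum_trees_Mult:
  fixes b :: "unit magma \<Rightarrow> 'k::field_char_0"
  assumes "\<And>v. b (Gen v) = 0" and "\<And>t. n < deg t \<Longrightarrow> b t = 0"
  shows "(\<Sum>t | deg t \<le> n. b t) = (\<Sum>s | deg s \<le> n. \<Sum>t | deg t \<le> n. b (s \<cdot> t))"
proof -
  let ?T = "{t :: unit magma. deg t \<le> n}"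
  let ?m = "\<lambda>(s, t). s \<cdot> t :: unit magma"
  have "sum b ?T = sum b (?m ` (?T \<times> ?T))"
  proof (rule sum.mono_neutral_cong)
    fix t assume "t \<in> ?T - ?m ` (?T \<times> ?T)"
    then show "b t = 0" using assms(1) by (cases t) force+
  qed (auto simp: finite_deg_le assms(2))
  also have "\<dots> = (\<Sum>p \<in> ?T \<times> ?T. b (?m p))"
    by (subst sum.reindex) (auto simp: inj_on_def)
  finally show ?thesis by (simp add: sum.cartesian_product case_prod_unfold)
qed

text \<open>The derivative of \<open>exp(x) exp(x) = exp(2x)\<close>. With \<open>A = exp - 1\<close> the equation reads
  \<open>exp(2x) - 2 exp(x) = A A - 1\<close>, and the derivative of its left-hand side has the coefficients
  \<open>(2\<^bsup>deg w + 1\<^esup> - 2) D(w)\<close>. The Leibniz rule for the product \<open>A A\<close> comes from summing the one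
  for trees over all pairs of trees.\<close>

lemma a_series_deriv_scaled:
  fixes w :: "unit monomial"
  defines "A \<equiv> a_series \<ominus> ns_one :: (unit, 'k::field_char_0) nseries"
    and "D \<equiv> ns_deriv a_series :: (unit, 'k) nseries"
  shows "(2 ^ Suc (mdeg w) - 2) * D w = (D \<otimes> A) w + (A \<otimes> D) w"
proof -
  define n where "n = Suc (mdeg w)"
  let ?T = "{t :: unit magma. deg t \<le> n}"
  let ?\<delta> = "\<lambda>t u. if u = Some t then 1 else 0 :: 'k"
  have D: "D u = (\<Sum>t \<in> ?T. a_coeff t * tree_deriv t u)" if "mdeg u \<le> mdeg w" for u
    using that ns_deriv_eq_sum[of u n a_series] by (simp add: D_def n_def)
  have A: "A u = (\<Sum>t \<in> ?T. a_coeff t * ?\<delta> t u)" if "mdeg u \<le> mdeg w" for u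
  proof (cases u)
    case (Some p)
    then have "p \<in> ?T" using that by (simp add: n_def)
    then show ?thesis
      using Some by (simp add: A_def ns_minus_def ns_one_def finite_deg_le if_distrib cong: if_cong)
  qed (simp add: A_def ns_minus_def ns_one_def)
  have fac: "mdeg u \<le> mdeg w \<and> mdeg v \<le> mdeg w" if "(u, v) \<in> factorizations w" for u v
    using that by (auto simp: factorizations_def)
  define b :: "unit magma \<Rightarrow> 'k"
    where "b t = (2 ^ deg t - 2) * a_coeff t * tree_deriv t w" for t
  have prod: "(F \<otimes> G) w =
      (\<Sum>s \<in> ?T. \<Sum>t \<in> ?T. a_coeff s * a_coeff t * (f s \<otimes> g t) w)"
    if F: "\<And>u. mdeg u \<le> mdeg w \<Longrightarrow> F u = (\<Sum>t \<in> ?T. a_coeff t * f t u)"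
      and G: "\<And>u. mdeg u \<le> mdeg w \<Longrightarrow> G u = (\<Sum>t \<in> ?T. a_coeff t * g t u)"
    for F G :: "(unit, 'k) nseries" and f g
  proof -
    have "(F \<otimes> G) w = (\<Sum>p \<in> factorizations w. \<Sum>s \<in> ?T. \<Sum>t \<in> ?T.
        a_coeff s * a_coeff t * (f s (fst p) * g t (snd p)))"
      unfolding ns_mult_alt
    proof (intro sum.cong refl, clarify)
      fix u v assume "(u, v) \<in> factorizations w"
      then show "F u * G v = (\<Sum>s \<in> ?T. \<Sum>t \<in> ?T.
          a_coeff s * a_coeff t * (f s (fst (u, v)) * g t (snd (u, v))))"
        using fac[of u v] by (simp add: F G sum_product mult_ac)
    qed
    also have "\<dots> = (\<Sum>s \<in> ?T. \<Sum>p \<in> factorizations w. \<Sum>t \<in> ?T.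
        a_coeff s * a_coeff t * (f s (fst p) * g t (snd p)))"
      by (rule sum.swap)
    also have "\<dots> = (\<Sum>s \<in> ?T. \<Sum>t \<in> ?T. \<Sum>p \<in> factorizations w.
        a_coeff s * a_coeff t * (f s (fst p) * g t (snd p)))"
      by (intro sum.cong refl sum.swap)
    finally show ?thesis
      by (simp add: ns_mult_alt sum_distrib_left case_prod_unfold)
  qed
  have "(2 ^ n - 2) * D w = (\<Sum>t \<in> ?T. b t)"
    unfolding D[OF order_refl] sum_distrib_left
  proof (intro sum.cong refl)
    fix t :: "unit magma"
    show "(2 ^ n - 2) * (a_coeff t * tree_deriv t w) = b t"
      using tree_deriv_eq_0[of t w, where 'k = 'k] by (cases "deg t = n") (auto simp: b_def n_def)
  qed
  also have "\<dots> = (\<Sum>s \<in> ?T. \<Sum>t \<in> ?T. b (s \<cdot> t))"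
  proof (rule sum_trees_Mult)
    show "b t = 0" if "n < deg t" for t
      using that tree_deriv_eq_0[of t w, where 'k = 'k] by (simp add: b_def n_def)
  qed (simp add: b_def)
  also have "\<dots> = (\<Sum>s \<in> ?T. \<Sum>t \<in> ?T. a_coeff s * a_coeff t *
      ((tree_deriv s \<otimes> ?\<delta> t) w + (?\<delta> s \<otimes> tree_deriv t) w))"
  proof (intro sum.cong refl)
    fix s t :: "unit magma"
    show "b (s \<cdot> t) = a_coeff s * a_coeff t *
        ((tree_deriv s \<otimes> ?\<delta> t) w + (?\<delta> s \<otimes> tree_deriv t) w)"
      using two_power_deg_Mult[of s t, where 'k = 'k] by (simp add: b_def ns_add_def)
  qed
  also have "\<dots> = (D \<otimes> A) w + (A \<otimes> D) w"
  proof -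
    have "(D \<otimes> A) w =
        (\<Sum>s \<in> ?T. \<Sum>t \<in> ?T. a_coeff s * a_coeff t * (tree_deriv s \<otimes> ?\<delta> t) w)"
      by (rule prod) (fact D A)+
    moreover have "(A \<otimes> D) w =
        (\<Sum>s \<in> ?T. \<Sum>t \<in> ?T. a_coeff s * a_coeff t * (?\<delta> s \<otimes> tree_deriv t) w)"
      by (rule prod) (fact D A)+
    ultimately show ?thesis by (simp only: distrib_left sum.distrib)
  qed
  finally show ?thesis by (simp add: n_def)
qed

text \<open>At a tree \<open>p\<close> the product \<open>D A\<close> contributes \<open>D(1) a(p) = a(p)\<close> and a product of coefficients at
  proper subtrees. By induction the equation above then says
  \<open>(2N - 2) D(p) = 2 a(p) + 2 (N - 2) a(p)\<close> with \<open>N = 2\<^bsup>deg p\<^esup>\<close>.\<close>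

lemma ns_deriv_a_series: "ns_deriv a_series = (a_series :: (unit, 'k::field_char_0) nseries)"
proof
  let ?D = "ns_deriv a_series :: (unit, 'k) nseries"
  have None: "?D None = 1" by (simp add: ns_deriv_None)
  have Some: "?D (Some p) = a_coeff p" for p
  proof (induction p)
    case (Gen v)
    show ?case
      using a_series_deriv_scaled[of "Some (Gen v)", where 'k = 'k]
      by (simp add: None ns_minus_def ns_one_def)
  next
    case (Mult s t)
    define N where "N = (2 :: 'k) ^ (deg s + deg t)"
    have N: "N - 2 \<noteq> 0" unfolding N_def by (rule two_power_deg_Mult)
    have "2 * N - 2 \<noteq> 0"
      using two_power_ne_two[of "Suc (deg s + deg t)", where 'k = 'k] deg_pos[of s]
      by (simp add: N_def)
    have a: "a_coeff s * a_coeff t = (N - 2) * a_coeff (s \<cdot> t)"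
      using N by (simp add: N_def)
    have "(2 * N - 2) * ?D (Some (s \<cdot> t)) =
        2 * a_coeff (s \<cdot> t) + 2 * (a_coeff s * a_coeff t)"
      using a_series_deriv_scaled[of "Some (s \<cdot> t)", where 'k = 'k] Mult.IH
      by (simp add: None ns_minus_def ns_one_def N_def)
    also have "\<dots> = (2 * N - 2) * a_coeff (s \<cdot> t)"
      unfolding a by (simp add: algebra_simps del: a_coeff.simps)
    finally show ?case using \<open>2 * N - 2 \<noteq> 0\<close> by (metis mult_left_cancel)
  qed
  fix w show "?D w = a_series w"
    using None Some by (cases w) auto
qed

lemma is_exp_a_series: "is_exp (a_series :: (unit, 'k::field_char_0) nseries)"
  unfolding is_exp_def
proof (intro conjI ns_deriv_a_series)
  show "a_series \<otimes> a_series = ns_subst a_series (ns_scale (2 :: 'k) (ns_var ()))"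
  proof (rule series_eqI)
    fix s t :: "unit magma"
    define N where "N = (2 :: 'k) ^ (deg s + deg t)"
    have "N - 2 \<noteq> 0" unfolding N_def by (rule two_power_deg_Mult)
    then have "a_coeff s * a_coeff t = (N - 2) * a_coeff (s \<cdot> t)"
      by (simp add: N_def)
    then have "2 * a_coeff (s \<cdot> t) + a_coeff s * a_coeff t = a_coeff (s \<cdot> t) * N"
      by (simp add: algebra_simps del: a_coeff.simps)
    then show "(a_series \<otimes> a_series) (Some (s \<cdot> t)) =
        (ns_subst a_series (ns_scale 2 (ns_var ())) (Some (s \<cdot> t)) :: 'k)"
      by (simp add: ns_subst_scaled_var N_def del: a_coeff.simps)
  qed (simp_all add: ns_subst_None ns_scale_def[abs_def] ns_subst_scaled_var[unfolded ns_scale_def[abs_def]])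
qed simp

lemma is_exp_unique:
  assumes "is_exp E" shows "E = a_series"
proof -
  have None: "E None = 1" and double: "E \<otimes> E = ns_subst E (ns_scale 2 (ns_var ()))"
    and deriv: "ns_deriv E = E"
    using assms by (auto simp: is_exp_def)
  have Some: "E (Some p) = a_coeff p" for p
  proof (induction p)
    case (Gen v)
    show ?case using ns_deriv_None[of E] deriv None by simp
  next
    case (Mult s t)
    have "2 * E (Some (s \<cdot> t)) + E (Some s) * E (Some t) = 2 ^ deg (s \<cdot> t) * E (Some (s \<cdot> t))"
      using fun_cong[OF double, of "Some (s \<cdot> t)"]
      by (simp add: None ns_subst_scaled_var mult.commute)
    then have "(2 ^ (deg s + deg t) - 2) * E (Some (s \<cdot> t)) = a_coeff s * a_coeff t"
      unfolding Mult.IH by (simp add: algebra_simps)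
    then show ?case
      using two_power_deg_Mult[of s t, where 'k = 'a] by (simp add: eq_divide_eq mult.commute)
  qed
  show ?thesis
  proof
    fix w show "E w = a_series w" using None Some by (cases w) auto
  qed
qed

lemma na_exp_eq: "na_exp = a_series"
  unfolding na_exp_def using is_exp_a_series is_exp_unique by (rule the_equality)

lemma na_exp_None [simp]: "na_exp None = 1"
  by (simp add: na_exp_eq)

lemma exp_coeff_eq: "exp_coeff = a_coeff"
  by (simp add: fun_eq_iff exp_coeff_def na_exp_eq)


section \<open>Substitution into the exponential series\<close>

text \<open>This is the family \<open>c\<^sub>k(\<tau>)\<close> without the clause for \<open>k = deg \<tau>\<close>, which presupposes
  that \<open>h\<close> is \<open>1\<close> at the generators: the contribution of the trees of degree \<open>k\<close> to the coefficient of \<open>\<tau>\<close> in \<open>exp(h)\<close>. For \<open>k = 0\<close>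
  the sum is empty, and the value is \<open>0\<close>.\<close>

primrec exp_layer :: "('a magma \<Rightarrow> 'k::field_char_0) \<Rightarrow> 'a magma \<Rightarrow> nat \<Rightarrow> 'k" where
  "exp_layer h (Gen v) k = (if k = 1 then h (Gen v) else 0)"
| "exp_layer h (s \<cdot> t) k =
    (if k = 1 then h (s \<cdot> t)
     else 1 / (2 ^ k - 2) * (\<Sum>l = 1..k - 1. exp_layer h s l * exp_layer h t (k - l)))"

lemma exp_layer_1 [simp]: "exp_layer h t (Suc 0) = h t"
  by (cases t) auto

lemma sum_trees_deg_eq:
  fixes b :: "unit magma \<Rightarrow> 'k::field_char_0"
  assumes "2 \<le> k"
  shows "(\<Sum>u | deg u = k. b u) =
    (\<Sum>l = 1..k - 1. \<Sum>s | deg s = l. \<Sum>t | deg t = k - l. b (s \<cdot> t))"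
proof -
  let ?S = "SIGMA l:{1..k - 1}. {s :: unit magma. deg s = l} \<times> {t :: unit magma. deg t = k - l}"
  let ?m = "\<lambda>(l, s, t). s \<cdot> t :: unit magma"
  have "{u. deg u = k} = ?m ` ?S"
  proof (intro equalityI subsetI)
    fix u :: "unit magma" assume u: "u \<in> {u. deg u = k}"
    show "u \<in> ?m ` ?S"
    proof (cases u)
      case (Mult s t)
      then have "(deg s, s, t) \<in> ?S" using u deg_pos[of s] deg_pos[of t] by auto
      then show ?thesis using Mult by (intro image_eqI[of _ _ "(deg s, s, t)"]) auto
    qed (use u assms in auto)
  qed auto
  moreover have "inj_on ?m ?S" by (auto simp: inj_on_def)
  ultimately have "(\<Sum>u | deg u = k. b u) = (\<Sum>p \<in> ?S. b (?m p))"
    by (simp add: sum.reindex)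
  also have "\<dots> = (\<Sum>(l, p) \<in> ?S. b (case p of (s, t) \<Rightarrow> s \<cdot> t))"
    by (simp add: case_prod_unfold)
  also have "\<dots> = (\<Sum>l = 1..k - 1. \<Sum>p \<in> {s. deg s = l} \<times> {t. deg t = k - l}.
      b (case p of (s, t) \<Rightarrow> s \<cdot> t))"
    by (rule sum.Sigma[symmetric]) (auto simp: finite_deg_eq)
  finally show ?thesis by (simp add: sum.cartesian_product case_prod_unfold)
qed

lemma trees_deg_eq_1: "{t :: unit magma. deg t = Suc 0} = {Gen ()}"
  using trees_deg_le_1 by (auto simp: le_Suc_eq)

text \<open>The coefficient of \<open>st\<close> in \<open>u\<^sub>1(h) u\<^sub>2(h)\<close> is the product of the coefficients of \<open>s\<close> and
  \<open>t\<close>, since \<open>h\<close> has no constant term; and \<open>a(u\<^sub>1u\<^sub>2)\<close> factors up to \<open>2\<^sup>k - 2\<close>, which depends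
  only on the degree \<open>k\<close>. So for each splitting \<open>k = l + (k - l)\<close> the double sum is a product.\<close>

lemma exp_layer_eq:
  fixes h :: "('a, 'k::field_char_0) nseries"
  assumes h: "h None = 0"
  shows "(\<Sum>u | deg u = k. exp_coeff u * tree_eval h u (Some \<tau>)) = exp_layer (\<lambda>t. h (Some t)) \<tau> k"
proof (induction \<tau> arbitrary: k)
  case (Gen v)
  show ?case
  proof (cases "k = 1")
    case True
    then show ?thesis by (simp add: trees_deg_eq_1 exp_coeff_eq)
  next
    case False
    have "tree_eval h u (Some (Gen v)) = 0" if "deg u = k" for u
      using that False by (cases u) (auto simp: h)
    then show ?thesis using False by simp
  qed
next
  case (Mult s t)
  consider "k = 0" | "k = 1" | "2 \<le> k" by linarith
  then show ?case
  proof cases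
    case 1
    then show ?thesis by simp
  next
    case 2
    then show ?thesis by (simp add: trees_deg_eq_1 exp_coeff_eq)
  next
    case 3
    let ?a = "exp_coeff :: unit magma \<Rightarrow> 'k"
    have "(\<Sum>u | deg u = k. ?a u * tree_eval h u (Some (s \<cdot> t))) =
        (\<Sum>l = 1..k - 1. \<Sum>u | deg u = l. \<Sum>v | deg v = k - l.
          1 / (2 ^ k - 2) * ((?a u * tree_eval h u (Some s)) * (?a v * tree_eval h v (Some t))))"
      unfolding sum_trees_deg_eq[OF 3]
      by (intro sum.cong refl) (auto simp: h exp_coeff_eq)
    also have "\<dots> = 1 / (2 ^ k - 2) * (\<Sum>l = 1..k - 1.
        (\<Sum>u | deg u = l. ?a u * tree_eval h u (Some s)) *
        (\<Sum>v | deg v = k - l. ?a v * tree_eval h v (Some t)))"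
      by (simp only: sum_product) (simp only: sum_distrib_left)
    also have "\<dots> = 1 / (2 ^ k - 2) * (\<Sum>l = 1..k - 1.
        exp_layer (\<lambda>t. h (Some t)) s l * exp_layer (\<lambda>t. h (Some t)) t (k - l))"
      unfolding Mult.IH ..
    finally show ?thesis using 3 by simp
  qed
qed

lemma ns_subst_exp:
  assumes h: "h None = 0"
  shows "ns_subst na_exp h (Some \<tau>) = (\<Sum>k = 1..deg \<tau>. exp_layer (\<lambda>t. h (Some t)) \<tau> k)"
proof -
  let ?f = "\<lambda>u. exp_coeff u * tree_eval h u (Some \<tau>)"
  let ?T = "\<lambda>k. {u :: unit magma. deg u = k}"
  have "ns_subst na_exp h (Some \<tau>) =
      (\<Sum>u \<in> monomials (deg \<tau>). na_exp u * mono_eval h u (Some \<tau>))"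
    by (rule ns_subst_eq_sum) (simp_all add: h)
  also have "\<dots> = (\<Sum>u | deg u \<le> deg \<tau>. ?f u)"
    by (simp add: monomials_eq finite_deg_le sum.reindex mono_eval_def ns_one_def exp_coeff_def)
  also have "{u. deg u \<le> deg \<tau>} = (\<Union>k \<in> {1..deg \<tau>}. ?T k)"
    by (auto simp: Suc_le_eq deg_pos)
  also have "sum ?f \<dots> = (\<Sum>k = 1..deg \<tau>. sum ?f (?T k))"
    by (rule sum.UNION_disjoint) (auto simp: finite_deg_eq)
  finally show ?thesis by (simp add: exp_layer_eq[of h, OF h])
qed

lemma ns_subst_exp_split:
  assumes "h None = 0"
  shows "ns_subst na_exp h (Some \<tau>) = h (Some \<tau>) + (\<Sum>k = 2..deg \<tau>. exp_layer (\<lambda>t. h (Some t)) \<tau> k)"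
proof -
  have "{1..deg \<tau>} = insert 1 {2..deg \<tau>}" using deg_pos[of \<tau>] by auto
  then show ?thesis by (simp add: ns_subst_exp[of h, OF assms])
qed

lemma exp_layer_eq_0: "k = 0 \<or> deg \<tau> < k \<Longrightarrow> exp_layer h \<tau> k = 0"
proof (induction \<tau> arbitrary: k)
  case (Mult s t)
  have "exp_layer h s l * exp_layer h t (k - l) = 0" if "l \<in> {1..k - 1}" for l
  proof -
    have "deg s < l \<or> deg t < k - l" using that Mult.prems by auto
    then show ?thesis using Mult.IH by auto
  qed
  then show ?case using Mult.prems deg_pos[of s] by (auto intro: sum.neutral)
qed auto

text \<open>In top degree only the tree \<open>u = |\<tau>|\<close> contributes, with each leaf replaced by a generator, whose
  coefficient in \<open>h\<close> is \<open>1\<close>. In the recursion this is the summand \<open>l = deg s\<close>.\<close>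

lemma exp_layer_deg:
  assumes "\<And>v. h (Gen v) = 1"
  shows "exp_layer h \<tau> (deg \<tau>) = exp_coeff (shape \<tau>)"
proof (induction \<tau>)
  case (Gen v)
  then show ?case by (simp add: assms exp_coeff_eq)
next
  case (Mult s t)
  let ?n = "deg s + deg t"
  have "(\<Sum>l = 1..?n - 1. exp_layer h s l * exp_layer h t (?n - l)) =
      (\<Sum>l \<in> {deg s}. exp_layer h s l * exp_layer h t (?n - l))"
  proof (rule sum.mono_neutral_right)
    show "\<forall>l \<in> {1..?n - 1} - {deg s}. exp_layer h s l * exp_layer h t (?n - l) = 0"
    proof
      fix l assume l: "l \<in> {1..?n - 1} - {deg s}"
      then have "deg s < l \<or> deg t < ?n - l" by auto
      then show "exp_layer h s l * exp_layer h t (?n - l) = 0"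
        using exp_layer_eq_0 by fastforce
    qed
  qed (use deg_pos[of s] deg_pos[of t] in \<open>auto simp: Suc_le_eq\<close>)
  then show ?case
    using two_le_deg_Mult[of s t] Mult.IH by (simp add: exp_coeff_eq)
qed

lemma c_part_eq_exp_layer:
  assumes "\<And>v. h (Gen v) = 1"
  shows "c_part h \<tau> k = exp_layer h \<tau> k"
proof (induction \<tau> arbitrary: k)
  case (Mult s t)
  show ?case
    using exp_layer_deg[of h "s \<cdot> t", OF assms] exp_layer_eq_0[of k "s \<cdot> t" h] Mult.IH
    by (auto simp: not_le not_less)
qed simp


section \<open>The logarithm\<close>

lemma ns_subst_exp_minus_one:
  assumes "h None = 0"
  shows "ns_subst (na_exp \<ominus> ns_one) h = ns_subst na_exp h \<ominus> ns_one"
  by (simp add: ns_subst_minus[of h, OF assms] ns_subst_one)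

text \<open>Induction on trees, for all layers at once: the layers \<open>k \<noteq> 1\<close> at \<open>\<tau>\<close> depend on proper subtrees,
  and then the sum over all layers determines the layer \<open>k = 1\<close>, which is the series itself.\<close>

lemma ns_subst_exp_inj:
  assumes g: "g None = 0" and h: "h None = 0"
    and eq: "ns_subst (na_exp \<ominus> ns_one) g = ns_subst (na_exp \<ominus> ns_one) h"
  shows "g = h"
proof -
  let ?G = "exp_layer (\<lambda>t. g (Some t))" and ?H = "exp_layer (\<lambda>t. h (Some t))"
  have eq: "ns_subst na_exp g w = ns_subst na_exp h w" for w
    using fun_cong[OF eq, of w]
    by (simp add: ns_subst_exp_minus_one[of g, OF g] ns_subst_exp_minus_one[of h, OF h]
        ns_minus_def)
  have top: "?G \<tau> 1 = ?H \<tau> 1" if "\<And>k. k \<noteq> 1 \<Longrightarrow> ?G \<tau> k = ?H \<tau> k" for \<tau>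
    using eq[of "Some \<tau>"] that
    by (simp add: ns_subst_exp_split[of g, OF g] ns_subst_exp_split[of h, OF h])
  have layers: "?G \<tau> k = ?H \<tau> k" for \<tau> k
  proof (induction \<tau> arbitrary: k)
    case (Gen v)
    show ?case by (cases "k = 1") (use top[of "Gen v"] in auto)
  next
    case (Mult s t)
    have "?G (s \<cdot> t) k = ?H (s \<cdot> t) k" if "k \<noteq> 1" for k
      using that by (simp add: Mult.IH)
    with top[of "s \<cdot> t"] show ?case by (cases "k = 1") auto
  qed
  show ?thesis
  proof
    fix w show "g w = h w"
      using g h layers[of _ "Suc 0"] by (cases w) auto
  qed
qed

text \<open>Solving \<open>exp(h) = 1 + q\<close> for \<open>h\<close>. The recursion has to carry all layers of the solution, as the
  layer \<open>k = 1\<close> at a tree uses the higher layers at its subtrees; the solution is that layer.\<close>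

primrec log_layer :: "('a magma \<Rightarrow> 'k::field_char_0) \<Rightarrow> 'a magma \<Rightarrow> nat \<Rightarrow> 'k" where
  "log_layer q (Gen v) k = (if k = 1 then q (Gen v) else 0)"
| "log_layer q (s \<cdot> t) k =
    (let r = \<lambda>k. 1 / (2 ^ k - 2) * (\<Sum>l = 1..k - 1. log_layer q s l * log_layer q t (k - l))
     in if k = 1 then q (s \<cdot> t) - (\<Sum>j = 2..deg (s \<cdot> t). r j) else r k)"

lemma exp_layer_log_layer:
  "exp_layer (\<lambda>t. log_layer q t 1) \<tau> k = log_layer q \<tau> k"
  by (induction \<tau> arbitrary: k) (simp_all add: Let_def)

lemma log_layer_1:
  "log_layer q \<tau> 1 = q \<tau> - (\<Sum>k = 2..deg \<tau>. log_layer q \<tau> k)"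
  by (cases \<tau>) (auto simp: Let_def intro!: sum.cong)

lemma ns_subst_exp_surj:
  fixes q :: "('a, 'k::field_char_0) nseries"
  assumes q: "q None = 0"
  obtains h :: "('a, 'k) nseries"
  where "h None = 0" and "ns_subst (na_exp \<ominus> ns_one) h = q"
proof
  let ?l = "log_layer (\<lambda>t. q (Some t))"
  define h where "h w = (case w of None \<Rightarrow> 0 | Some t \<Rightarrow> ?l t 1)" for w
  show h: "h None = 0" by (simp add: h_def)
  have hS: "(\<lambda>t. h (Some t)) = (\<lambda>t. ?l t 1)" by (simp add: h_def fun_eq_iff)
  have "ns_subst na_exp h (Some \<tau>) = q (Some \<tau>)" for \<tau>
    unfolding ns_subst_exp_split[of h, OF h] hS exp_layer_log_layer
    using log_layer_1[of "\<lambda>t. q (Some t)" \<tau>] by (simp add: h_def)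
  then show "ns_subst (na_exp \<ominus> ns_one) h = q"
    unfolding ns_subst_exp_minus_one[of h, OF h]
    by (intro series_eqI) (simp_all add: ns_minus_def ns_one_def ns_subst_None[of h, OF h] q)
qed

text \<open>The right inverse \<open>L\<close> of \<open>P\<close> is a left inverse because \<open>P(L(P)) = (P(L))(P) = P = P(x)\<close> and
  substitution into \<open>P\<close> is injective. Injectivity also gives uniqueness.\<close>

lemma is_comp_inverse_na_log1p:
  "is_comp_inverse (na_exp \<ominus> ns_one) (na_log1p :: (unit, 'k::field_char_0) nseries)"
proof -
  let ?P = "na_exp \<ominus> ns_one :: (unit, 'k) nseries"
  have P: "?P None = 0" by (simp add: ns_minus_def ns_one_def)
  obtain L :: "(unit, 'k) nseries" where L: "L None = 0" and PL: "ns_subst ?P L = ns_var ()"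
    using ns_subst_exp_surj[of "ns_var ()"] by auto
  have LP0: "ns_subst L ?P None = 0" using L by (simp add: ns_subst_None[of ?P, OF P])
  have "ns_subst ?P (ns_subst L ?P) = ns_subst ?P (ns_var ())"
    by (simp add: ns_subst_assoc[of L ?P, OF L P] PL ns_subst_var_left ns_subst_var_right)
  then have "ns_subst L ?P = ns_var ()"
    using ns_subst_exp_inj[of "ns_subst L ?P" "ns_var ()"] LP0 by simp
  then have "is_comp_inverse ?P L" using L PL by (simp add: is_comp_inverse_def)
  moreover have "L' = L" if "is_comp_inverse ?P L'" for L' :: "(unit, 'k) nseries"
    using that ns_subst_exp_inj[of L' L] L PL by (simp add: is_comp_inverse_def)
  ultimately show ?thesis unfolding na_log1p_def by (rule theI)
qed


section \<open>The Hausdorff series\<close>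

lemma ns_subst_exp_log:
  assumes q: "q None = 0"
  shows "ns_subst na_log1p q None = 0"
    and "ns_subst (na_exp \<ominus> ns_one) (ns_subst na_log1p q) = q"
proof -
  have L: "na_log1p None = 0" and PL: "ns_subst (na_exp \<ominus> ns_one) na_log1p = ns_var ()"
    using is_comp_inverse_na_log1p by (auto simp: is_comp_inverse_def)
  show "ns_subst na_log1p q None = 0" using L by (simp add: ns_subst_None[of q, OF q])
  show "ns_subst (na_exp \<ominus> ns_one) (ns_subst na_log1p q) = q"
    by (simp add: ns_subst_assoc[of na_log1p q, OF L q] PL ns_subst_var_left)
qed

lemma exp_exp_None: "exp_exp None = 1"
  by (simp add: exp_exp_def ns_subst_None)

lemma hausdorff_None: "hausdorff None = 0"
  unfolding hausdorff_def
  by (rule ns_subst_exp_log) (simp add: ns_minus_def ns_one_def exp_exp_None)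

lemma ns_subst_exp_hausdorff: "ns_subst na_exp hausdorff (Some \<tau>) = exp_exp (Some \<tau>)"
proof -
  have "ns_subst (na_exp \<ominus> ns_one) hausdorff = exp_exp \<ominus> ns_one"
    unfolding hausdorff_def
    by (rule ns_subst_exp_log) (simp add: ns_minus_def ns_one_def exp_exp_None)
  then have "ns_subst na_exp hausdorff \<ominus> ns_one = exp_exp \<ominus> ns_one"
    by (simp add: ns_subst_exp_minus_one[of hausdorff, OF hausdorff_None])
  from fun_cong[OF this, of "Some \<tau>"] show ?thesis
    by (simp add: ns_minus_def ns_one_def)
qed

text \<open>A tree with leaves of both kinds arises in \<open>exp(x) exp(y)\<close> only as a product of a tree in \<open>x\<close> and
  a tree in \<open>y\<close>; the trees in one variable come from multiplying by the constant term of the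
  other factor.\<close>

lemma exp_exp_Some:
  "exp_exp (Some \<tau>) =
     (if \<tau> \<in> M {X} \<or> \<tau> \<in> M {Y} then exp_coeff (shape \<tau>)
      else case \<tau> of
          Gen v \<Rightarrow> 0
        | \<tau>\<^sub>1 \<cdot> \<tau>\<^sub>2 \<Rightarrow>
            if \<tau>\<^sub>1 \<in> M {X} \<and> \<tau>\<^sub>2 \<in> M {Y}
            then exp_coeff (shape \<tau>\<^sub>1) * exp_coeff (shape \<tau>\<^sub>2)
            else 0)"
proof -
  have disjoint: "\<not> (t \<in> M {X} \<and> t \<in> M {Y})" for t
    by (induction t) auto
  show ?thesis
  proof (cases \<tau>)
    case (Gen v)
    then show ?thesis
      by (cases v) (simp_all add: exp_exp_def ns_subst_None ns_subst_var exp_coeff_def)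
  next
    case (Mult s t)
    then show ?thesis
      using disjoint[of s] disjoint[of t]
      by (auto simp: exp_exp_def ns_subst_None ns_subst_var exp_coeff_def)
  qed
qed

lemma hausdorff_Gen: "hausdorff (Some (Gen v)) = (1 :: 'k::field_char_0)"
proof -
  have "hausdorff (Some (Gen v)) = (exp_exp (Some (Gen v)) :: 'k)"
    using ns_subst_exp_split[of "hausdorff :: (var, 'k) nseries" "Gen v", OF hausdorff_None]
    by (simp add: ns_subst_exp_hausdorff)
  also have "\<dots> = 1"
    by (cases v) (simp_all add: exp_exp_Some exp_coeff_eq)
  finally show ?thesis .
qed

theorem proposition6p3:
  fixes c d :: "var magma \<Rightarrow> 'k::field_char_0"
  assumes c: "\<And>\<tau>. c \<tau> = hausdorff (Some \<tau>)"
    and d: "\<And>\<tau>. d \<tau> = exp_exp (Some \<tau>)"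
  shows "(hausdorff :: (var, 'k) nseries) None = 0
    \<and> (\<forall>\<tau>. c \<tau> = d \<tau> - (\<Sum>k = 2..deg \<tau>. c_part c \<tau> k))
    \<and> (\<forall>\<tau>. d \<tau> =
           (if \<tau> \<in> M {X} \<or> \<tau> \<in> M {Y} then exp_coeff (shape \<tau>)
            else case \<tau> of
                Gen v \<Rightarrow> 0
              | \<tau>\<^sub>1 \<cdot> \<tau>\<^sub>2 \<Rightarrow>
                  if \<tau>\<^sub>1 \<in> M {X} \<and> \<tau>\<^sub>2 \<in> M {Y}
                  then exp_coeff (shape \<tau>\<^sub>1) * exp_coeff (shape \<tau>\<^sub>2)
                  else 0))"
proof (intro conjI allI)
  show "(hausdorff :: (var, 'k) nseries) None = 0" by (rule hausdorff_None)
next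
  fix \<tau>
  have "c (Gen v) = 1" for v by (simp add: c hausdorff_Gen)
  then have part: "c_part c \<tau> k = exp_layer c \<tau> k" for k
    by (rule c_part_eq_exp_layer)
  have cS: "(\<lambda>t. hausdorff (Some t)) = c" using c by auto
  have "d \<tau> = c \<tau> + (\<Sum>k = 2..deg \<tau>. exp_layer c \<tau> k)"
    using ns_subst_exp_split[of "hausdorff :: (var, 'k) nseries" \<tau>, OF hausdorff_None]
    unfolding ns_subst_exp_hausdorff cS by (simp only: c d)
  then show "c \<tau> = d \<tau> - (\<Sum>k = 2..deg \<tau>. c_part c \<tau> k)"
    by (simp add: part)
qed (unfold d, rule exp_exp_Some)

end
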